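(* (i) For every integer $k \geq 2$ there exists a connected graph $G$ with minimum degree $2$ and $\gamma_p(G) = k$ such that, writing $n$ for the order of $G$, $rad_p(G) = n - k - 2k + 1$. (ii) For every integer $\delta \geq 3$ there exists a connected graph $G$ with minimum degree $\delta$ and $\gamma_p(G) = 2$ such that, writing $n$ for the order of $G$, $rad_p(G) = n - \delta - 2$.
   Context: All graphs are finite, simple, undirected and non-empty. For a graph $G$ and $S \subseteq V(G)$, define $P^1_G(S) = N[S]$ (the closed neighbourhood of $S$), and for $i \geq 1$ let $V^i = \{v \in P^i_G(S) : |N[v] \setminus P^i_G(S)| \leq 1\}$ and $P^{i+1}_G(S) = P^i_G(S) \cup N[V^i]$. The set $S$ is a power dominating set (PDS) of $G$ if $P^i_G(S) = V(G)$ for some $i \ge 1$. The power domination number $\gamma_p(G)$ is the minimum cardinality of a PDS of $G$. For a PDS $S$, $rad_p(G,S) = \min\{i \geq 1 : P^i_G(S) = V(G)\}$. The propagation radius of $G$ is $rad_p(G) = \min\{rad_p(G,S) : S \text{ is a PDS of } G \text{ with } |S| = \gamma_p(G)\}$. *)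

theory Defs
  imports "Graph_Theory.Graph_Theory"
begin

text \<open>
  Finite simple undirected graphs are the symmetric, loop-free finite digraphs of the locale
  \<^locale>\<open>pair_graph\<close>: an edge between u and v is the pair of arcs (u, v) and (v, u). Hence the degree
  of a vertex is its out-degree. The definitions below are only meant for such graphs.
\<close>

definition closed_nbhd :: "('a, 'b) pre_digraph \<Rightarrow> 'a \<Rightarrow> 'a set" where
  "closed_nbhd G v = insert v {u. v \<rightarrow>\<^bsub>G\<^esub> u}"

definition closed_nbhd_set :: "('a, 'b) pre_digraph \<Rightarrow> 'a set \<Rightarrow> 'a set" where
  "closed_nbhd_set G S = (\<Union>v\<in>S. closed_nbhd G v)"

definition min_degree :: "('a, 'b) pre_digraph \<Rightarrow> nat" where
  "min_degree G = Min (out_degree G ` verts G)"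

text \<open>
  The sets are indexed from 1; the value at index 0 is a dummy, and every use below restricts
  the index to be at least 1.
\<close>

fun monitored :: "('a, 'b) pre_digraph \<Rightarrow> 'a set \<Rightarrow> nat \<Rightarrow> 'a set" where
  "monitored G S 0 = S"
| "monitored G S (Suc 0) = closed_nbhd_set G S"
| "monitored G S (Suc (Suc i)) =
     monitored G S (Suc i) \<union>
     closed_nbhd_set G {v \<in> monitored G S (Suc i).
                          card (closed_nbhd G v - monitored G S (Suc i)) \<le> 1}"

definition power_dominating_set :: "('a, 'b) pre_digraph \<Rightarrow> 'a set \<Rightarrow> bool" where
  "power_dominating_set G S \<longleftrightarrow> S \<subseteq> verts G \<and> (\<exists>i\<ge>1. monitored G S i = verts G)"

definition power_domination_number :: "('a, 'b) pre_digraph \<Rightarrow> nat" where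
  "power_domination_number G = Min {card S |S. power_dominating_set G S}"

definition set_propagation_radius :: "('a, 'b) pre_digraph \<Rightarrow> 'a set \<Rightarrow> nat" where
  "set_propagation_radius G S = (LEAST i. i \<ge> 1 \<and> monitored G S i = verts G)"

definition propagation_radius :: "('a, 'b) pre_digraph \<Rightarrow> nat" where
  "propagation_radius G =
     Min {set_propagation_radius G S |S.
            power_dominating_set G S \<and> card S = power_domination_number G}"

end

theory Submission
  imports Defs
begin

text \<open>
  Both families have propagation radius 1, so only a dominating set of size \<open>\<gamma>\<^sub>p\<close> is needed. For (i) attach
  a triangle to every vertex of a complete graph on k vertices, giving \<open>n = 3k\<close>: the two new vertices of a
  triangle are never monitored from outside. For (ii) take the complement of a disjoint union of
  triangles and 4-cycles on \<open>n = \<delta> + 3\<close> vertices. The two vertices x, y missed by the closed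
  neighbourhood of v have the same neighbours outside \<open>{x, y}\<close>, so propagation from \<open>{v}\<close> never
  reaches them, whereas two vertices of different cycles dominate.
\<close>

section \<open>Forts: vertex sets that propagation cannot enter\<close>

text \<open>While \<open>F\<close> is wholly unmonitored, a monitored vertex lies outside
  \<open>F\<close>; if it has a neighbour in \<open>F\<close>, it has two, both unmonitored, so it
  fails the test for propagating.\<close>

lemma fort_not_monitored:
  assumes fin: "finite (arcs_ends G)"
    and fort: "\<And>w f. w \<notin> F \<Longrightarrow> f \<in> F \<Longrightarrow> w \<rightarrow>\<^bsub>G\<^esub> f \<Longrightarrow> \<exists>f'\<in>F. f' \<noteq> f \<and> w \<rightarrow>\<^bsub>G\<^esub> f'"
    and init: "closed_nbhd_set G S \<inter> F = {}"
    and "i \<ge> 1"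
  shows "monitored G S i \<inter> F = {}"
  using \<open>i \<ge> 1\<close>
proof (induction i rule: dec_induct)
  case base
  then show ?case using init by simp
next
  case (step i)
  then obtain j where i: "i = Suc j" by (cases i) auto
  let ?M = "monitored G S i"
  have False if w: "w \<in> ?M" "card (closed_nbhd G w - ?M) \<le> 1" and f: "f \<in> closed_nbhd G w" "f \<in> F" for w f
  proof -
    have "w \<notin> F" using w step.IH by auto
    then have wf: "w \<rightarrow>\<^bsub>G\<^esub> f" using f by (auto simp: closed_nbhd_def)
    then obtain f' where f': "f' \<in> F" "f' \<noteq> f" "w \<rightarrow>\<^bsub>G\<^esub> f'" using fort \<open>w \<notin> F\<close> f(2) by blast
    have "{f, f'} \<subseteq> closed_nbhd G w - ?M"
      using wf f f' step.IH by (auto simp: closed_nbhd_def)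
    \<comment> \<open>An infinite set has \<open>card\<close> 0 and would pass the test
      \<open>\<le> 1\<close>, so finiteness matters here.\<close>
    moreover have "finite (closed_nbhd G w)"
    proof -
      have "{u. w \<rightarrow>\<^bsub>G\<^esub> u} \<subseteq> snd ` arcs_ends G" by force
      then show ?thesis using fin by (auto simp: closed_nbhd_def intro: finite_subset)
    qed
    ultimately have "card {f, f'} \<le> card (closed_nbhd G w - ?M)" by (intro card_mono) auto
    then show False using w(2) f'(2) by auto
  qed
  then show ?case using step.IH unfolding i by (auto simp: closed_nbhd_set_def)
qed

text \<open>The source of both lower bounds on \<open>power_domination_number\<close>.\<close>

lemma power_dominating_set_meets_fort:
  assumes "power_dominating_set G S" "finite (arcs_ends G)"
    and "\<And>w f. w \<notin> F \<Longrightarrow> f \<in> F \<Longrightarrow> w \<rightarrow>\<^bsub>G\<^esub> f \<Longrightarrow> \<exists>f'\<in>F. f' \<noteq> f \<and> w \<rightarrow>\<^bsub>G\<^esub> f'"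
    and "F \<subseteq> verts G" "F \<noteq> {}"
  shows "closed_nbhd_set G S \<inter> F \<noteq> {}"
proof
  assume "closed_nbhd_set G S \<inter> F = {}"
  then have "monitored G S i \<inter> F = {}" if "i \<ge> 1" for i
    using fort_not_monitored[of G F S i] assms that by blast
  then show False using assms unfolding power_dominating_set_def by blast
qed

text \<open>A dominating set is finished at index 1, the least index allowed. If no power dominating
  set is smaller, it attains both minima, so no propagation has to be traced.\<close>

lemma minimum_dominating_set_radius:
  assumes fin: "finite (verts G)" and D: "D \<subseteq> verts G" "closed_nbhd_set G D = verts G"
    and min: "\<And>S. power_dominating_set G S \<Longrightarrow> card D \<le> card S"
  shows "power_domination_number G = card D" and "propagation_radius G = 1"
proof -
  have dom: "monitored G D 1 = verts G" using D by simp
  then have pds: "power_dominating_set G D" using D unfolding power_dominating_set_def by blast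
  \<comment> \<open>\<open>Min\<close> is only meaningful on finite sets.\<close>
  have finS: "finite {S. power_dominating_set G S}"
    by (rule finite_subset[OF _ finite_Pow_iff[THEN iffD2, OF fin]]) (auto simp: power_dominating_set_def)
  show num: "power_domination_number G = card D"
    unfolding power_domination_number_def
    using finS pds min by (intro Min_eqI) (auto simp: setcompr_eq_image)
  \<comment> \<open>\<open>LEAST\<close> satisfies its predicate only if some index does; power
    domination supplies one.\<close>
  have "set_propagation_radius G S \<ge> 1" if pdsS: "power_dominating_set G S" for S
  proof -
    obtain i where "i \<ge> 1 \<and> monitored G S i = verts G"
      using pdsS unfolding power_dominating_set_def by blast
    then show ?thesis
      unfolding set_propagation_radius_def
      by (rule LeastI2[where a = i and P = "\<lambda>i. i \<ge> 1 \<and> monitored G S i = verts G"]) simp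
  qed
  moreover have "set_propagation_radius G D = 1"
    unfolding set_propagation_radius_def using dom by (intro Least_equality) auto
  moreover have "finite {S. power_dominating_set G S \<and> card S = card D}"
    by (rule finite_subset[OF _ finS]) auto
  ultimately show "propagation_radius G = 1"
    unfolding propagation_radius_def num
    by (intro Min_eqI) (use pds in \<open>auto simp: setcompr_eq_image intro: rev_image_eqI\<close>)
qed

section \<open>Degrees, connectedness and graphs given by relations\<close>

lemma out_degree_with_proj: "out_degree (with_proj G) v = card {u. (v, u) \<in> parcs G}"
proof -
  have "out_arcs (with_proj G) v = Pair v ` {u. (v, u) \<in> parcs G}"
    by (auto simp: out_arcs_def)
  then show ?thesis by (simp add: out_degree_def card_image inj_on_def)
qed

text \<open>Walks reverse in a symmetric graph, so any two vertices are joined through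
  \<open>c\<close>. Connectedness means strong connectedness of the symmetric closure, hence the
  final transfer to \<open>mk_symmetric\<close>.\<close>

lemma (in pair_graph) connectedI_reachable_from:
  assumes "c \<in> pverts G" "\<And>v. v \<in> pverts G \<Longrightarrow> c \<rightarrow>\<^sup>*\<^bsub>with_proj G\<^esub> v"
  shows "Digraph_Component.connected (with_proj G)"
  unfolding connected_def
proof (rule strongly_connectedI)
  show "verts (with_proj (mk_symmetric (with_proj G))) \<noteq> {}" using assms(1) by auto
next
  fix u v assume "u \<in> verts (with_proj (mk_symmetric (with_proj G)))"
    "v \<in> verts (with_proj (mk_symmetric (with_proj G)))"
  then have "u \<rightarrow>\<^sup>*\<^bsub>with_proj G\<^esub> c" "c \<rightarrow>\<^sup>*\<^bsub>with_proj G\<^esub> v" using assms(2) symmetric_reachable' by auto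
  then have "u \<rightarrow>\<^sup>*\<^bsub>with_proj G\<^esub> v" by (rule reachable_trans)
  then show "u \<rightarrow>\<^sup>*\<^bsub>with_proj (mk_symmetric (with_proj G))\<^esub> v" by (rule reachable_mk_symmetricI)
qed

definition rel_graph :: "nat \<Rightarrow> (nat \<Rightarrow> nat \<Rightarrow> bool) \<Rightarrow> nat pair_pre_digraph" where
  "rel_graph n R = \<lparr>pverts = {..<n}, parcs = {(i, j). i < n \<and> j < n \<and> R i j}\<rparr>"

lemma rel_graph_simps [simp]:
  "pverts (rel_graph n R) = {..<n}"
  "(i, j) \<in> parcs (rel_graph n R) \<longleftrightarrow> i < n \<and> j < n \<and> R i j"
  by (auto simp: rel_graph_def)

lemma finite_parcs_rel_graph [simp]: "finite (parcs (rel_graph n R))"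
  by (rule finite_subset[of _ "{..<n} \<times> {..<n}"]) (auto simp: rel_graph_def)

lemma pair_graph_rel_graph:
  assumes "\<And>i. i < n \<Longrightarrow> \<not> R i i" "\<And>i j. i < n \<Longrightarrow> j < n \<Longrightarrow> R i j \<Longrightarrow> R j i"
  shows "pair_graph (rel_graph n R)"
proof unfold_locales
  show "symmetric (with_proj (rel_graph n R))"
    using assms(2) by (auto simp: symmetric_def sym_def)
qed (use assms(1) in auto)

section \<open>The family of minimum degree 2\<close>

text \<open>Block \<open>h\<close> is the triangle \<open>3 * h\<close>, \<open>3 * h + 1\<close>,
  \<open>3 * h + 2\<close>; the multiples of 3 carry the complete graph, and the other two vertices
  of a block have no neighbour outside it.\<close>

lemma triangle_corona:
  assumes k: "k \<ge> 1"
  defines "G \<equiv> rel_graph (3 * k) (\<lambda>i j. i \<noteq> j \<and> (i div 3 = j div 3 \<or> 3 dvd i \<and> 3 dvd j))"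
  shows "pair_graph G \<and> Digraph_Component.connected (with_proj G) \<and> min_degree (with_proj G) = 2 \<and>
    power_domination_number (with_proj G) = k \<and> propagation_radius (with_proj G) = 1"
proof -
  have pg: "pair_graph G" unfolding G_def by (rule pair_graph_rel_graph) auto
  interpret pair_graph G by fact
  have block: "v = 3 * (v div 3) \<or> v = 3 * (v div 3) + 1 \<or> v = 3 * (v div 3) + 2" for v :: nat
    by presburger
  have conn: "Digraph_Component.connected (with_proj G)"
  proof (rule connectedI_reachable_from)
    show "0 \<in> pverts G" using k by (simp add: G_def)
  next
    fix v assume "v \<in> pverts G"
    then have v: "v < 3 * k" by (simp add: G_def)
    let ?h = "3 * (v div 3)"
    have h: "?h < 3 * k" using v by linarith
    have "0 \<rightarrow>\<^sup>*\<^bsub>with_proj G\<^esub> ?h"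
    proof (cases "?h = 0")
      case True
      then show ?thesis using k reachable_refl[of 0] by (simp add: G_def)
    next
      case False
      then have "(0, ?h) \<in> parcs G" using h by (simp add: G_def)
      then show ?thesis by simp
    qed
    moreover have "?h \<rightarrow>\<^sup>*\<^bsub>with_proj G\<^esub> v"
    proof (cases "?h = v")
      case True
      then show ?thesis using v reachable_refl[of v] by (simp add: G_def)
    next
      case False
      then have "(?h, v) \<in> parcs G" using h v by (simp add: G_def)
      then show ?thesis by simp
    qed
    ultimately show "0 \<rightarrow>\<^sup>*\<^bsub>with_proj G\<^esub> v" by (rule reachable_trans)
  qed
  have deg_ge: "2 \<le> out_degree (with_proj G) v" if v: "v < 3 * k" for v
  proof -
    let ?h = "3 * (v div 3)"
    have h: "?h + 2 < 3 * k" using v by presburger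
    have "card ({?h, ?h + 1, ?h + 2} - {v}) = 2" using block[of v] by auto
    moreover have "{?h, ?h + 1, ?h + 2} - {v} \<subseteq> {u. (v, u) \<in> parcs G}"
      using h v by (auto simp: G_def)
    moreover have "finite {u. (v, u) \<in> parcs G}"
      by (rule finite_subset[of _ "{..<3 * k}"]) (auto simp: G_def)
    ultimately show ?thesis unfolding out_degree_with_proj by (metis card_mono)
  qed
  \<comment> \<open>Vertex 1 is an attached vertex of block 0 and attains the bound.\<close>
  have "{u. (1, u) \<in> parcs G} = {0, 2}"
    using k by (auto simp: G_def)
  then have deg1: "out_degree (with_proj G) 1 = 2" by (simp add: out_degree_with_proj)
  have mindeg: "min_degree (with_proj G) = 2"
    unfolding min_degree_def
    by (rule Min_eqI) (use deg_ge deg1 k in \<open>auto simp: G_def intro!: rev_image_eqI[of 1]\<close>)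
  let ?D = "(\<lambda>h. 3 * h) ` {..<k}"
  have cardD: "card ?D = k" by (subst card_image) (auto simp: inj_on_def)
  have "v \<in> closed_nbhd_set (with_proj G) ?D" if v: "v < 3 * k" for v
  proof -
    have "v div 3 < k" using v by linarith
    moreover have "v \<in> closed_nbhd (with_proj G) (3 * (v div 3))"
      using v by (auto simp: G_def closed_nbhd_def)
    ultimately show ?thesis unfolding closed_nbhd_set_def by blast
  qed
  then have dom: "closed_nbhd_set (with_proj G) ?D = verts (with_proj G)"
    by (auto simp: G_def closed_nbhd_set_def closed_nbhd_def)
  have lower: "card ?D \<le> card S" if S: "power_dominating_set (with_proj G) S" for S
  proof -
    have Ssub: "S \<subseteq> {..<3 * k}" using S by (auto simp: power_dominating_set_def G_def)
    \<comment> \<open>\<open>S\<close> must meet every block, so \<open>v div 3\<close> maps it onto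
      the \<open>k\<close> block indices.\<close>
    have "h \<in> (\<lambda>v. v div 3) ` S" if h: "h < k" for h
    proof -
      let ?F = "{3 * h + 1, 3 * h + 2}"
      have "closed_nbhd_set (with_proj G) S \<inter> ?F \<noteq> {}"
      proof (rule power_dominating_set_meets_fort[OF S])
        fix w f assume w: "w \<notin> ?F" "f \<in> ?F" "w \<rightarrow>\<^bsub>with_proj G\<^esub> f"
        \<comment> \<open>\<open>f\<close> is no multiple of 3, so its neighbours stay in its block;
          thus \<open>w\<close> is \<open>3 * h\<close>, adjacent to both members of the
          fort.\<close>
        then have "w div 3 = h" "w < 3 * k" by (auto simp: G_def) presburger+
        then have "\<forall>f'\<in>?F. w \<rightarrow>\<^bsub>with_proj G\<^esub> f'" using w(1) h by (auto simp: G_def)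
        then show "\<exists>f'\<in>?F. f' \<noteq> f \<and> w \<rightarrow>\<^bsub>with_proj G\<^esub> f'" by auto
      qed (use h in \<open>auto simp: G_def\<close>)
      then obtain v f where "v \<in> S" "f \<in> ?F" "f \<in> closed_nbhd (with_proj G) v"
        unfolding closed_nbhd_set_def by blast
      then have "v div 3 = h" by (auto simp: closed_nbhd_def G_def) presburger+
      then show ?thesis using \<open>v \<in> S\<close> by blast
    qed
    then have "{..<k} \<subseteq> (\<lambda>v. v div 3) ` S" by blast
    then have "card {..<k} \<le> card S"
      using Ssub finite_subset surj_card_le[of S "{..<k}"] by blast
    then show ?thesis using cardD by simp
  qed
  have "?D \<subseteq> verts (with_proj G)" by (auto simp: G_def)
  note minimum_dominating_set_radius[OF _ this dom lower]
  then show ?thesis using pg conn mindeg cardD by (simp add: G_def)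
qed

section \<open>The family of minimum degree at least 3\<close>

text \<open>
  \<open>M v\<close> is the neighbourhood of v in a 2-regular graph; the last clause forces the components of
  this graph to be triangles and 4-cycles.
\<close>

definition twin_cycles :: "nat \<Rightarrow> (nat \<Rightarrow> nat set) \<Rightarrow> bool" where
  "twin_cycles n M \<longleftrightarrow> (\<forall>v<n. v \<notin> M v \<and> M v \<subseteq> {..<n} \<and> card (M v) = 2 \<and> (\<forall>w\<in>M v. v \<in> M w) \<and>
     (\<forall>x\<in>M v. \<forall>y\<in>M v. M x - {y} = M y - {x}))"

text \<open>This is a disjoint union: \<open>M\<close> stays below \<open>m\<close> and
  \<open>B\<close> stays in \<open>{m..<n}\<close>, so each clause at \<open>v\<close> only sees the
  part containing \<open>v\<close>.\<close>

lemma twin_cycles_append: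
  assumes M: "twin_cycles m M"
    and B: "\<And>v. v \<in> {m..<n} \<Longrightarrow> v \<notin> B v \<and> B v \<subseteq> {m..<n} \<and> card (B v) = 2 \<and> (\<forall>w\<in>B v. v \<in> B w) \<and>
      (\<forall>x\<in>B v. \<forall>y\<in>B v. B x - {y} = B y - {x})"
    and "m \<le> n"
  shows "twin_cycles n (\<lambda>v. if v < m then M v else B v)"
  unfolding twin_cycles_def
proof (intro allI impI)
  fix v assume v: "v < n"
  let ?M = "\<lambda>v. if v < m then M v else B v"
  show "v \<notin> ?M v \<and> ?M v \<subseteq> {..<n} \<and> card (?M v) = 2 \<and> (\<forall>w\<in>?M v. v \<in> ?M w) \<and>
     (\<forall>x\<in>?M v. \<forall>y\<in>?M v. ?M x - {y} = ?M y - {x})"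
  proof (cases "v < m")
    case True
    then have old: "v \<notin> M v \<and> M v \<subseteq> {..<m} \<and> card (M v) = 2 \<and> (\<forall>w\<in>M v. v \<in> M w) \<and>
        (\<forall>x\<in>M v. \<forall>y\<in>M v. M x - {y} = M y - {x})"
      using M unfolding twin_cycles_def by blast
    then have "?M w = M w" if "w \<in> M v" for w using that by auto
    moreover have "M v \<subseteq> {..<n}" using old \<open>m \<le> n\<close> by auto
    ultimately show ?thesis using True old by simp
  next
    case False
    then have "v \<in> {m..<n}" using v by simp
    from B[OF this] have new: "v \<notin> B v \<and> B v \<subseteq> {m..<n} \<and> card (B v) = 2 \<and> (\<forall>w\<in>B v. v \<in> B w) \<and>
        (\<forall>x\<in>B v. \<forall>y\<in>B v. B x - {y} = B y - {x})" .
    then have "?M w = B w" if "w \<in> B v" for w using that by auto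
    moreover have "B v \<subseteq> {..<n}" using new by auto
    ultimately show ?thesis using False new by simp
  qed
qed

lemma twin_cycles_add_triangle:
  assumes "twin_cycles m M"
  shows "twin_cycles (m + 3) (\<lambda>v. if v < m then M v else {m..<m + 3} - {v})"
  by (rule twin_cycles_append[OF assms]) auto

text \<open>The 4-cycle is written as the complete bipartite graph between \<open>{m, m + 1}\<close>
  and \<open>{m + 2, m + 3}\<close>; the two neighbours of a vertex form one side and share their
  neighbourhood.\<close>

lemma twin_cycles_add_square:
  assumes "twin_cycles m M"
  shows "twin_cycles (m + 4)
    (\<lambda>v. if v < m then M v else if v < m + 2 then {m + 2, m + 3} else {m, m + 1})"
  by (rule twin_cycles_append[OF assms]) auto

text \<open>Every \<open>n \<ge> 3\<close> except 5 is a sum of 3s and 4s. Splitting off a triangle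
  leaves an admissible order unless \<open>n\<close> is 3, 4 or 8, and these are built directly from
  the empty graph.\<close>

lemma twin_cycles_exist:
  assumes "n \<ge> 3" "n \<noteq> 5"
  shows "\<exists>M. twin_cycles n M"
  using assms
proof (induction n rule: less_induct)
  case (less n)
  have empty: "twin_cycles 0 (\<lambda>_. {})" by (simp add: twin_cycles_def)
  consider "n = 3" | "n = 4" | "n = 8" | m where "n = m + 3" "m \<ge> 3" "m \<noteq> 5"
    using less.prems by (cases "n \<in> {3, 4, 8}") (auto intro: that(4)[of "n - 3"])
  then show ?case
  proof cases
    case 1
    then show ?thesis using twin_cycles_add_triangle[OF empty] by auto
  next
    case 2
    then show ?thesis using twin_cycles_add_square[OF empty] by auto
  next
    case 3
    then show ?thesis using twin_cycles_add_square[OF twin_cycles_add_square[OF empty]] by auto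
  next
    case 4
    then show ?thesis using less.IH[of m] twin_cycles_add_triangle by auto
  qed
qed

text \<open>From order 6 on there are at least two cycles: \<open>u\<close> is vertex 0 and
  \<open>v\<close> the first vertex of the cycle added last. Order 8 is split as 4 + 4, since
  removing a triangle would leave 5.\<close>

lemma twin_cycles_exist_separated:
  assumes "n \<ge> 6"
  shows "\<exists>M u v. twin_cycles n M \<and> u < n \<and> v < n \<and> u \<noteq> v \<and> v \<notin> M u \<and> M u \<inter> M v = {}"
proof -
  have sub: "M 0 \<subseteq> {..<m}" if "twin_cycles m M" "m > 0" for m M
    using that unfolding twin_cycles_def by blast
  show ?thesis
  proof (cases "n = 8")
    case True
    obtain M where M: "twin_cycles 4 M" using twin_cycles_exist[of 4] by auto
    let ?M = "\<lambda>v. if v < 4 then M v else if v < 4 + 2 then {4 + 2, 4 + 3} else {4, 4 + 1}"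
    have "twin_cycles n ?M" using twin_cycles_add_square[OF M] True by simp
    moreover have "4 \<notin> ?M 0" "?M 0 \<inter> ?M 4 = {}" using sub[OF M] by auto
    ultimately show ?thesis using True by (intro exI[of _ ?M] exI[of _ 0] exI[of _ 4]) auto
  next
    case False
    then obtain m where n: "n = m + 3" "m \<ge> 3" "m \<noteq> 5"
      using assms by (intro that[of "n - 3"]) auto
    then obtain M where M: "twin_cycles m M" using twin_cycles_exist by blast
    let ?M = "\<lambda>v. if v < m then M v else {m..<m + 3} - {v}"
    have "twin_cycles n ?M" using twin_cycles_add_triangle[OF M] n by simp
    moreover have "m \<notin> ?M 0" "?M 0 \<inter> ?M m = {}" using sub[OF M] n by auto
    ultimately show ?thesis using n by (intro exI[of _ ?M] exI[of _ 0] exI[of _ m]) auto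
  qed
qed

lemma complement_twin_cycles:
  assumes M: "twin_cycles n M" and uv: "u < n" "v < n" "u \<noteq> v" "v \<notin> M u" "M u \<inter> M v = {}"
  defines "G \<equiv> rel_graph n (\<lambda>i j. i \<noteq> j \<and> j \<notin> M i)"
  shows "pair_graph G \<and> Digraph_Component.connected (with_proj G) \<and> min_degree (with_proj G) = n - 3 \<and>
    power_domination_number (with_proj G) = 2 \<and> propagation_radius (with_proj G) = 1"
proof -
  have sub: "M i \<subseteq> {..<n}" and irr: "i \<notin> M i" if "i < n" for i
    using M that unfolding twin_cycles_def by auto
  have sym: "i \<in> M j \<longleftrightarrow> j \<in> M i" if "i < n" "j < n" for i j
    using M that unfolding twin_cycles_def by blast
  have pg: "pair_graph G" unfolding G_def by (rule pair_graph_rel_graph) (use sym in auto)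
  interpret pair_graph G by fact
  have arc: "(i, j) \<in> parcs G \<longleftrightarrow> i < n \<and> j < n \<and> i \<noteq> j \<and> j \<notin> M i" for i j
    by (simp add: G_def)
  have uv_arc: "(u, v) \<in> parcs G" using uv arc by blast
  \<comment> \<open>A vertex other than \<open>u\<close> that is not adjacent to \<open>u\<close>
    lies in \<open>M u\<close>; hence it is neither \<open>v\<close> nor in \<open>M v\<close>, and
    \<open>v\<close> is adjacent to it.\<close>
  have cover: "w = u \<or> (u, w) \<in> parcs G \<or> (v, w) \<in> parcs G" if "w < n" for w
    using that uv arc by blast
  have conn: "Digraph_Component.connected (with_proj G)"
  proof (rule connectedI_reachable_from)
    show "u \<in> pverts G" using uv by (simp add: G_def)
  next
    fix w assume "w \<in> pverts G"
    then have "w < n" by (simp add: G_def)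
    moreover have "u \<rightarrow>\<^sup>*\<^bsub>with_proj G\<^esub> v" using uv_arc by simp
    ultimately show "u \<rightarrow>\<^sup>*\<^bsub>with_proj G\<^esub> w"
      using cover[of w] \<open>w \<in> pverts G\<close> by (auto intro: reachable_adj_trans)
  qed
  \<comment> \<open>Each vertex misses exactly itself and the two members of \<open>M i\<close>, so
    the complement is regular.\<close>
  have deg: "out_degree (with_proj G) i = n - 3" if i: "i < n" for i
  proof -
    have "{j. (i, j) \<in> parcs G} = {..<n} - insert i (M i)" using i by (auto simp: G_def)
    moreover have fin: "finite (M i)" using sub[OF i] by (rule finite_subset) simp
    moreover have "card (insert i (M i)) = 3"
      using M i irr[OF i] fin unfolding twin_cycles_def by simp
    moreover have "insert i (M i) \<subseteq> {..<n}" using sub[OF i] i by simp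
    ultimately show ?thesis
      by (simp only: out_degree_with_proj card_Diff_subset finite_insert card_lessThan)
  qed
  have mindeg: "min_degree (with_proj G) = n - 3"
  proof -
    have "out_degree (with_proj G) ` {..<n} = {n - 3}" using deg uv by force
    then show ?thesis by (simp add: min_degree_def G_def)
  qed
  have dom: "closed_nbhd_set (with_proj G) {u, v} = verts (with_proj G)"
  proof
    show "verts (with_proj G) \<subseteq> closed_nbhd_set (with_proj G) {u, v}"
      using cover by (auto simp: closed_nbhd_set_def closed_nbhd_def G_def)
  qed (use uv in \<open>auto simp: closed_nbhd_set_def closed_nbhd_def G_def\<close>)
  have lower: "card {u, v} \<le> card S" if S: "power_dominating_set (with_proj G) S" for S
  proof (rule ccontr)
    assume "\<not> card {u, v} \<le> card S"
    then have "card S \<le> 1" using uv by simp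
    have Ssub: "S \<subseteq> {..<n}" using S by (auto simp: power_dominating_set_def G_def)
    then have "finite S" by (rule finite_subset) simp
    \<comment> \<open>One \<open>c\<close> serves both cases: for empty \<open>S\<close> any vertex
      will do.\<close>
    obtain c where c: "c < n" "S \<subseteq> {c}"
    proof (cases "S = {}")
      case False
      then have "card S = 1" using \<open>card S \<le> 1\<close> \<open>finite S\<close> by (simp add: le_eq_less_or_eq)
      then obtain c where "S = {c}" by (auto simp: card_1_singleton_iff)
      then show ?thesis using that Ssub by auto
    qed (use that uv in blast)
    have twins: "card (M c) = 2" "\<forall>x\<in>M c. \<forall>y\<in>M c. M x - {y} = M y - {x}"
      using M c(1) unfolding twin_cycles_def by blast+
    from twins(1) obtain x y where xy: "x \<noteq> y" "M c = {x, y}" unfolding card_2_iff by blast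
    have swap: "M x - {y} = M y - {x}"
      by (rule twins(2)[rule_format]) (use xy(2) in blast)+
    have "x < n" "y < n" using xy(2) sub[OF c(1)] by auto
    have "closed_nbhd_set (with_proj G) S \<inter> {x, y} \<noteq> {}"
    proof (rule power_dominating_set_meets_fort[OF S])
      fix w f assume w: "w \<notin> {x, y}" "f \<in> {x, y}" "w \<rightarrow>\<^bsub>with_proj G\<^esub> f"
      then have wn: "w < n" by (simp add: G_def)
      \<comment> \<open>Outside \<open>{x, y}\<close>, the twin clause and symmetry of
        \<open>M\<close> make a vertex adjacent in the complement to both of \<open>x\<close>,
        \<open>y\<close> or to neither, so the pair is a fort.\<close>
      have "w \<in> M x \<longleftrightarrow> w \<in> M y" using swap w(1) by blast
      then have "x \<in> M w \<longleftrightarrow> y \<in> M w" using sym wn \<open>x < n\<close> \<open>y < n\<close> by blast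
      then have "\<forall>f'\<in>{x, y}. w \<rightarrow>\<^bsub>with_proj G\<^esub> f'"
        using w wn \<open>x < n\<close> \<open>y < n\<close> by (auto simp: G_def)
      then show "\<exists>f'\<in>{x, y}. f' \<noteq> f \<and> w \<rightarrow>\<^bsub>with_proj G\<^esub> f'" using xy(1) by auto
    qed (use \<open>x < n\<close> \<open>y < n\<close> in \<open>auto simp: G_def\<close>)
    \<comment> \<open>\<open>x\<close> and \<open>y\<close> form \<open>M c\<close>, which is
      exactly what the closed neighbourhood of \<open>c\<close> misses.\<close>
    moreover have "closed_nbhd_set (with_proj G) S \<inter> {x, y} = {}"
      using c xy irr[OF c(1)] by (auto simp: closed_nbhd_set_def closed_nbhd_def G_def)
    ultimately show False by simp
  qed
  have "{u, v} \<subseteq> verts (with_proj G)" using uv by (auto simp: G_def)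
  note minimum_dominating_set_radius[OF _ this dom lower]
  then show ?thesis using pg conn mindeg uv by (simp add: G_def)
qed

section \<open>Matching the orders to the required radius\<close>

theorem mainTheorem4:
  shows "(\<forall>k::nat. k \<ge> 2 \<longrightarrow>
           (\<exists>G :: nat pair_pre_digraph.
              pair_graph G \<and> Digraph_Component.connected (with_proj G) \<and>
              min_degree (with_proj G) = 2 \<and>
              power_domination_number (with_proj G) = k \<and>
              int (propagation_radius (with_proj G))
                = int (card (pverts G)) - int k - 2 * int k + 1)) \<and>
         (\<forall>\<delta>::nat. \<delta> \<ge> 3 \<longrightarrow>
           (\<exists>G :: nat pair_pre_digraph.
              pair_graph G \<and> Digraph_Component.connected (with_proj G) \<and>
              min_degree (with_proj G) = \<delta> \<and>
              power_domination_number (with_proj G) = 2 \<and>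
              int (propagation_radius (with_proj G))
                = int (card (pverts G)) - int \<delta> - 2))"
proof (intro conjI allI impI)
  \<comment> \<open>The order is \<open>3 * k\<close>, so the required value is 1.\<close>
  fix k :: nat assume "k \<ge> 2"
  then show "\<exists>G :: nat pair_pre_digraph. pair_graph G \<and> Digraph_Component.connected (with_proj G) \<and>
      min_degree (with_proj G) = 2 \<and> power_domination_number (with_proj G) = k \<and>
      int (propagation_radius (with_proj G)) = int (card (pverts G)) - int k - 2 * int k + 1"
    using triangle_corona[of k] by (intro exI[of _ "rel_graph (3 * k) _"]) auto
next
  \<comment> \<open>The order \<open>\<delta> + 3\<close> gives degree \<delta> and required value
    1; \<open>\<delta> \<ge> 3\<close> makes it at least 6, leaving room for two cycles.\<close>
  fix \<delta> :: nat assume "\<delta> \<ge> 3"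
  then obtain M u v where "twin_cycles (\<delta> + 3) M" "u < \<delta> + 3" "v < \<delta> + 3" "u \<noteq> v" "v \<notin> M u" "M u \<inter> M v = {}"
    using twin_cycles_exist_separated[of "\<delta> + 3"] by auto
  from complement_twin_cycles[OF this]
  show "\<exists>G :: nat pair_pre_digraph. pair_graph G \<and> Digraph_Component.connected (with_proj G) \<and>
      min_degree (with_proj G) = \<delta> \<and> power_domination_number (with_proj G) = 2 \<and>
      int (propagation_radius (with_proj G)) = int (card (pverts G)) - int \<delta> - 2"
    by (intro exI[of _ "rel_graph (\<delta> + 3) _"]) auto
qed

end
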